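(* Let $\Delta$ be a pure simplicial complex of dimension $d-1$ on $[n]$. Then $$L_j(\Delta^{(d-i)})^{sq}=L_i(\Delta^{(d-j)})^{sq}$$ for all integers $i,j$ with $1\le i,j\le d$.
   Context: Let $K$ be a field, $[n]=\{1,\ldots,n\}$ and $S=K[x_1,\ldots,x_n]$. A simplicial complex on $[n]$ is a nonempty collection of subsets (faces) of $[n]$ closed under taking subsets; facets are maximal faces, $\dim F=|F|-1$, $\dim\Delta$ is the maximal dimension of a face, and $\Delta$ is pure if all facets have the same dimension. The $i$-skeleton $\Delta^{(i)}$ is the simplicial complex of all faces $F\in\Delta$ with $\dim F\le i$. For a simplicial complex $\Gamma$ on $[n]$ and $k\ge 0$, a $k$-cover of $\Gamma$ is a nonzero vector $c\in\mathbb{Z}_{\ge 0}^n$ with $\sum_{i\in F}c_i\ge k$ for every facet $F$ of $\Gamma$; it is squarefree if all $c_i\le 1$. Write $x^c=x_1^{c_1}\cdots x_n^{c_n}$. $B(\Gamma)\subseteq S[t]$ is the $S$-subalgebra generated by all $x^ct^k$ with $k\geq 1$ and $c$ a squarefree $k$-cover of $\Gamma$; write $B(\Gamma)=\bigoplus_{k\ge 0}L_k(\Gamma)t^k$, where each $L_k(\Gamma)$ is a monomial ideal of $S$. For a monomial ideal $I$, $I^{sq}$ is the ideal generated by all squarefree monomials in $I$. *)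

theory Defs
  imports "HOL-Library.Poly_Mapping" "HOL-Computational_Algebra.Polynomial"
begin

text \<open>
  The vertex set $[n]$ is the universe of a finite type \<open>'n\<close>, so $n$ is the cardinality of
  \<open>'n\<close>. (The case
  $n = 0$ is excluded: there the only complex has dimension $-1$.) The ring $S = K[x_1, \ldots, x_n]$ is the type
  \<open>('n, 'k) mvpoly\<close> and $S[t]$ is \<open>('n, 'k) mvpoly poly\<close>.
\<close>

type_synonym ('n, 'k) mvpoly = "('n \<Rightarrow>\<^sub>0 nat) \<Rightarrow>\<^sub>0 'k"

definition xpow :: "('n \<Rightarrow>\<^sub>0 nat) \<Rightarrow> ('n, 'k::comm_ring_1) mvpoly" where
  "xpow c = Poly_Mapping.single c 1"

definition sqfree_exponent :: "('n \<Rightarrow>\<^sub>0 nat) \<Rightarrow> bool" where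
  "sqfree_exponent c \<longleftrightarrow> (\<forall>v. Poly_Mapping.lookup c v \<le> 1)"


section \<open>Simplicial complexes\<close>

definition simplicial_complex :: "'n set set \<Rightarrow> bool" where
  "simplicial_complex \<Delta> \<longleftrightarrow> \<Delta> \<noteq> {} \<and> (\<forall>F\<in>\<Delta>. \<forall>G. G \<subseteq> F \<longrightarrow> G \<in> \<Delta>)"

definition facets :: "'n set set \<Rightarrow> 'n set set" where
  "facets \<Delta> = {F \<in> \<Delta>. \<forall>G\<in>\<Delta>. F \<subseteq> G \<longrightarrow> G = F}"

definition face_dim :: "'n set \<Rightarrow> int" where
  "face_dim F = int (card F) - 1"

definition complex_dim :: "'n::finite set set \<Rightarrow> int" where
  "complex_dim \<Delta> = Max (face_dim ` \<Delta>)"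

definition pure_complex :: "'n set set \<Rightarrow> bool" where
  "pure_complex \<Delta> \<longleftrightarrow> (\<forall>F\<in>facets \<Delta>. \<forall>G\<in>facets \<Delta>. face_dim F = face_dim G)"

definition skeleton :: "int \<Rightarrow> 'n set set \<Rightarrow> 'n set set" where
  "skeleton i \<Delta> = {F \<in> \<Delta>. face_dim F \<le> i}"


section \<open>Vertex covers and the algebra $B(\Gamma)$\<close>

definition is_cover :: "'n set set \<Rightarrow> nat \<Rightarrow> ('n \<Rightarrow>\<^sub>0 nat) \<Rightarrow> bool" where
  "is_cover \<Gamma> k c \<longleftrightarrow> c \<noteq> 0 \<and> (\<forall>F\<in>facets \<Gamma>. k \<le> (\<Sum>v\<in>F. Poly_Mapping.lookup c v))"

inductive_set poly_subalgebra :: "'a::comm_ring_1 poly set \<Rightarrow> 'a poly set"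
  for A :: "'a poly set" where
  gen: "p \<in> A \<Longrightarrow> p \<in> poly_subalgebra A"
| const: "[:s:] \<in> poly_subalgebra A"
| add: "p \<in> poly_subalgebra A \<Longrightarrow> q \<in> poly_subalgebra A \<Longrightarrow> p + q \<in> poly_subalgebra A"
| mult: "p \<in> poly_subalgebra A \<Longrightarrow> q \<in> poly_subalgebra A \<Longrightarrow> p * q \<in> poly_subalgebra A"

definition B_alg :: "'n::finite set set \<Rightarrow> ('n, 'k::field) mvpoly poly set" where
  "B_alg \<Gamma> = poly_subalgebra
     {monom (xpow c) k | c k. 1 \<le> k \<and> is_cover \<Gamma> k c \<and> sqfree_exponent c}"

text \<open>The graded component $L_k(\Gamma)$ of $B(\Gamma)$; see \<open>B_alg_decomp\<close> for the decomposition.\<close>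

definition L_ideal :: "nat \<Rightarrow> 'n::finite set set \<Rightarrow> ('n, 'k::field) mvpoly set" where
  "L_ideal k \<Gamma> = {f. monom f k \<in> B_alg \<Gamma>}"

text \<open>The ideal generated by \<open>A\<close> is its span in the ring as a module over itself.\<close>

lemma module_times: "module ((*) :: 'a::comm_ring_1 \<Rightarrow> 'a \<Rightarrow> 'a)"
  by unfold_locales (auto simp: algebra_simps)

definition ideal_gen :: "'a::comm_ring_1 set \<Rightarrow> 'a set" where
  "ideal_gen A = module.span (*) A"

definition sq_part :: "('n::finite, 'k::field) mvpoly set \<Rightarrow> ('n, 'k) mvpoly set" where
  "sq_part I = ideal_gen {xpow c | c. sqfree_exponent c \<and> xpow c \<in> I}"


section \<open>Grading of $B(\Gamma)$\<close>

lemma monom_coeff_in_B_alg: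
  fixes \<Gamma> :: "'n::finite set set" and p :: "('n, 'k::field) mvpoly poly"
  assumes "p \<in> B_alg \<Gamma>"
  shows "monom (coeff p m) m \<in> B_alg \<Gamma>"
  using assms unfolding B_alg_def
proof (induction arbitrary: m rule: poly_subalgebra.induct)
  case (gen p)
  then obtain c k where p: "p = monom (xpow c) k" by blast
  show ?case
  proof (cases "m = k")
    case True
    then show ?thesis using gen p by (auto intro!: poly_subalgebra.gen)
  next
    case False
    then show ?thesis using p poly_subalgebra.const[of 0] by simp
  qed
next
  case (const s)
  then show ?case
    using poly_subalgebra.const[of s] poly_subalgebra.const[of 0]
    by (cases m) (auto simp: monom_0)
next
  case (add p q)
  then show ?case by (simp add: add_monom[symmetric] poly_subalgebra.add)
next
  case (mult p q)
  let ?A = "poly_subalgebra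
     {monom (xpow c :: ('n, 'k) mvpoly) k | c k. 1 \<le> k \<and> is_cover \<Gamma> k c \<and> sqfree_exponent c}"
  have sum_in: "(\<Sum>i\<in>I. f i) \<in> ?A" if "finite I" "\<And>i. i \<in> I \<Longrightarrow> f i \<in> ?A" for f and I :: "nat set"
    using that
    by (induction I) (use poly_subalgebra.const[of 0] in \<open>auto intro: poly_subalgebra.add\<close>)
  have "monom (coeff (p * q) m) m =
      (\<Sum>i\<le>m. monom (coeff p i) i * monom (coeff q (m - i)) (m - i))"
  proof -
    have "monom (\<Sum>i\<in>I. f i) m = (\<Sum>i\<in>I. monom (f i) m)"
      for f :: "nat \<Rightarrow> ('n, 'k) mvpoly" and I
      by (induction I rule: infinite_finite_induct) (simp_all flip: add_monom)
    then show ?thesis by (simp add: coeff_mult mult_monom)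
  qed
  also have "\<dots> \<in> ?A"
    using mult by (intro sum_in poly_subalgebra.mult) auto
  finally show ?case .
qed

lemma B_alg_decomp: "p \<in> B_alg \<Gamma> \<longleftrightarrow> (\<forall>k. coeff p k \<in> L_ideal k \<Gamma>)"
proof
  assume "p \<in> B_alg \<Gamma>"
  then show "\<forall>k. coeff p k \<in> L_ideal k \<Gamma>"
    by (simp add: L_ideal_def monom_coeff_in_B_alg)
next
  assume *: "\<forall>k. coeff p k \<in> L_ideal k \<Gamma>"
  have "(\<Sum>i\<in>I. monom (coeff p i) i) \<in> B_alg \<Gamma>" if "finite I" for I
    using that
  proof (induction I)
    case empty
    then show ?case using poly_subalgebra.const[of 0] by (simp add: B_alg_def)
  next
    case (insert i I)
    then show ?case using * by (simp add: L_ideal_def B_alg_def poly_subalgebra.add)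
  qed
  from this[of "{..degree p}"] show "p \<in> B_alg \<Gamma>"
    by (simp add: poly_as_sum_of_monoms)
qed

end

theory Submission
  imports Defs
begin

text \<open>
  A subset \<open>C\<close> of the vertices meets every \<open>(d - i + 1)\<close>-subset of a facet \<open>G\<close> of \<open>\<Delta>\<close> in at
  least \<open>k \<ge> 1\<close> points if and only if it meets \<open>G\<close> in at least \<open>i + k - 1\<close> points: the worst
  subset spends its \<open>i - 1\<close> omissions on as many points of \<open>C \<inter> G\<close> as possible. As \<open>\<Delta>\<close> is
  pure, these subsets are exactly the facets of the skeleton \<open>\<Delta>\<^sup>(\<^sup>d\<^sup>-\<^sup>i\<^sup>)\<close>, so a squarefree \<open>k\<close>-cover of the skeleton is the same thing as a
  squarefree \<open>(i + k - 1)\<close>-cover of \<open>\<Delta>\<close> (\<open>is_cover_skeleton_iff\<close>).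

  Products of generators of the algebra contribute no further squarefree monomials. If
  \<open>x\<^sup>a t\<^sup>k\<close> and \<open>x\<^sup>b t\<^sup>l\<close> with \<open>k, l \<ge> 1\<close> satisfy the bounds \<open>i + k - 1\<close> and \<open>i + l - 1\<close> on every
  facet of \<open>\<Delta>\<close>, then \<open>a + b\<close> satisfies the bound \<open>2 i + k + l - 2\<close>, and this is at least
  \<open>i + (k + l) - 1\<close> because \<open>i \<ge> 1\<close>. Hence a squarefree \<open>x\<^sup>c\<close> lies in
  \<open>L\<^sub>j(\<Delta>\<^sup>(\<^sup>d\<^sup>-\<^sup>i\<^sup>))\<close> if and only if \<open>c\<close> is an \<open>(i + j - 1)\<close>-cover of \<open>\<Delta>\<close>
  (\<open>xpow_in_L_ideal_skeleton_iff\<close>), a condition symmetric in \<open>i\<close> and \<open>j\<close>.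
\<close>

lemma face_subset_facet:
  fixes \<Delta> :: "'n::finite set set"
  assumes "F \<in> \<Delta>"
  shows "\<exists>G\<in>facets \<Delta>. F \<subseteq> G"
proof -
  obtain G where "G \<in> \<Delta>" "F \<subseteq> G" "\<forall>H\<in>\<Delta>. G \<subseteq> H \<longrightarrow> G = H"
    using finite_has_maximal2[OF finite assms] by blast
  then show ?thesis
    by (intro bexI[of _ G]) (auto simp: facets_def)
qed

lemma card_facet_of_pure_complex:
  fixes \<Delta> :: "'n::finite set set"
  assumes "simplicial_complex \<Delta>" "pure_complex \<Delta>" "complex_dim \<Delta> = int d - 1"
    and "G \<in> facets \<Delta>"
  shows "card G = d"
proof -
  have "\<Delta> \<noteq> {}"
    using assms(1) by (simp add: simplicial_complex_def)
  then have "Max (face_dim ` \<Delta>) \<in> face_dim ` \<Delta>"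
    by (intro Max_in) auto
  then obtain F where F: "F \<in> \<Delta>" "face_dim F = int d - 1"
    using assms(3) by (auto simp: complex_dim_def)
  obtain H where H: "H \<in> facets \<Delta>" "F \<subseteq> H"
    using face_subset_facet[OF F(1)] by blast
  have "face_dim H \<le> int d - 1"
    unfolding assms(3)[symmetric] complex_dim_def
    using H(1) by (intro Max_ge) (auto simp: facets_def)
  moreover have "card F \<le> card H"
    using H(2) by (simp add: card_mono)
  moreover have "face_dim G = face_dim H"
    using assms(2,4) H(1) unfolding pure_complex_def by blast
  ultimately show ?thesis
    using F(2) by (simp add: face_dim_def)
qed

text \<open>
  By purity every face extends inside a facet with \<open>d\<close> vertices, so a face with fewer than
  \<open>d + 1 - i\<close> vertices is not maximal in the skeleton.
\<close>

lemma facets_skeleton: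
  fixes \<Delta> :: "'n::finite set set"
  assumes "simplicial_complex \<Delta>" "pure_complex \<Delta>" "complex_dim \<Delta> = int d - 1"
    and "1 \<le> i" "i \<le> d"
  shows "facets (skeleton (int d - int i) \<Delta>) = {F \<in> \<Delta>. card F = d + 1 - i}"
proof (intro equalityI subsetI)
  fix F assume F: "F \<in> facets (skeleton (int d - int i) \<Delta>)"
  then have F': "F \<in> \<Delta>" "card F \<le> d + 1 - i"
    using assms(5) by (auto simp: facets_def skeleton_def face_dim_def)
  obtain G where G: "G \<in> facets \<Delta>" "F \<subseteq> G"
    using face_subset_facet[OF F'(1)] by blast
  have "card G = d"
    using card_facet_of_pure_complex assms(1-3) G(1) by blast
  then have "d + 1 - i \<le> card G"
    using assms(4) by simp
  then obtain H where H: "F \<subseteq> H" "H \<subseteq> G" "card H = d + 1 - i"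
    using exists_subset_between[OF F'(2) _ G(2) finite] by blast
  have "H \<in> \<Delta>"
    using assms(1) G(1) H(2) unfolding simplicial_complex_def facets_def by blast
  then have "H \<in> skeleton (int d - int i) \<Delta>"
    using H(3) assms(5) by (simp add: skeleton_def face_dim_def)
  then have "H = F"
    using F H(1) by (auto simp: facets_def)
  then show "F \<in> {F \<in> \<Delta>. card F = d + 1 - i}"
    using F'(1) H(3) by simp
next
  fix F assume F: "F \<in> {F \<in> \<Delta>. card F = d + 1 - i}"
  have "H = F" if "H \<in> skeleton (int d - int i) \<Delta>" "F \<subseteq> H" for H
  proof -
    have "card H \<le> card F"
      using that(1) F assms(5) by (auto simp: skeleton_def face_dim_def)
    then show ?thesis
      using card_seteq[OF finite that(2)] by simp
  qed
  then show "F \<in> facets (skeleton (int d - int i) \<Delta>)"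
    using F assms(5) by (auto simp: facets_def skeleton_def face_dim_def)
qed

text \<open>
  For a squarefree \<open>c\<close> the sum of \<open>c\<close> over a set counts its points in the support of \<open>c\<close>. If \<open>G\<close>
  contains at most \<open>m\<close> support points, deleting a superset of them leaves the sum \<open>0 < k\<close>;
  otherwise, deleting \<open>m\<close> of them is the worst case and lowers the sum by exactly \<open>m\<close>.
\<close>

lemma sqfree_sum_subsets_ge_iff:
  fixes c :: "'n \<Rightarrow>\<^sub>0 nat"
  assumes "sqfree_exponent c" "finite G" "m \<le> card G" "1 \<le> k"
  shows "(\<forall>F\<subseteq>G. card F = card G - m \<longrightarrow> k \<le> (\<Sum>v\<in>F. Poly_Mapping.lookup c v)) \<longleftrightarrow>
         m + k \<le> (\<Sum>v\<in>G. Poly_Mapping.lookup c v)"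
proof
  let ?s = "\<lambda>F. \<Sum>v\<in>F. Poly_Mapping.lookup c v"
  define C where "C = {v \<in> G. Poly_Mapping.lookup c v \<noteq> 0}"
  have C: "C \<subseteq> G" "finite C"
    using assms(2) by (auto simp: C_def)
  have one: "Poly_Mapping.lookup c v = 1" if "v \<in> C" for v
    using that assms(1) by (simp add: C_def sqfree_exponent_def le_antisym Suc_leI)
  assume *: "\<forall>F\<subseteq>G. card F = card G - m \<longrightarrow> k \<le> ?s F"
  show "m + k \<le> ?s G"
  proof (cases "card C \<le> m")
    case True
    then obtain T where T: "C \<subseteq> T" "T \<subseteq> G" "card T = m"
      using exists_subset_between[OF _ assms(3) C(1) assms(2)] by blast
    have "card (G - T) = card G - m"
      using T assms(2) by (simp add: card_Diff_subset finite_subset)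
    then have "k \<le> ?s (G - T)"
      using * by auto
    moreover have "?s (G - T) = 0"
      using T(1) by (intro sum.neutral) (auto simp: C_def)
    ultimately show ?thesis
      using assms(4) by simp
  next
    case False
    then obtain T where T: "T \<subseteq> C" "card T = m"
      using obtain_subset_with_card_n[of m C] by auto
    have "T \<subseteq> G"
      using T(1) C(1) by blast
    then have "card (G - T) = card G - m"
      using T(2) assms(2) by (simp add: card_Diff_subset finite_subset)
    then have "k \<le> ?s (G - T)"
      using * by auto
    moreover have "?s T = m"
      using T one by (simp add: subset_iff)
    ultimately show ?thesis
      using sum.subset_diff[OF \<open>T \<subseteq> G\<close> assms(2), of "Poly_Mapping.lookup c"] by linarith
  qed
next
  let ?s = "\<lambda>F. \<Sum>v\<in>F. Poly_Mapping.lookup c v"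
  assume *: "m + k \<le> ?s G"
  show "\<forall>F\<subseteq>G. card F = card G - m \<longrightarrow> k \<le> ?s F"
  proof (intro allI impI)
    fix F assume F: "F \<subseteq> G" "card F = card G - m"
    have "?s (G - F) \<le> card (G - F)"
      using sum_bounded_above[of "G - F" "Poly_Mapping.lookup c" 1] assms(1)
      by (simp add: sqfree_exponent_def)
    also have "\<dots> = m"
      using F assms(2,3) by (simp add: card_Diff_subset finite_subset)
    finally show "k \<le> ?s F"
      using * sum.subset_diff[OF F(1) assms(2), of "Poly_Mapping.lookup c"] by linarith
  qed
qed

lemma is_cover_skeleton_iff:
  fixes \<Delta> :: "'n::finite set set"
  assumes "simplicial_complex \<Delta>" "pure_complex \<Delta>" "complex_dim \<Delta> = int d - 1"
    and "1 \<le> i" "i \<le> d" "1 \<le> k" "sqfree_exponent c"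
  shows "is_cover (skeleton (int d - int i) \<Delta>) k c \<longleftrightarrow> is_cover \<Delta> (i + k - 1) c"
proof -
  let ?s = "\<lambda>F. \<Sum>v\<in>F. Poly_Mapping.lookup c v"
  have "(\<forall>F\<in>facets (skeleton (int d - int i) \<Delta>). k \<le> ?s F) \<longleftrightarrow>
        (\<forall>G\<in>facets \<Delta>. \<forall>F\<subseteq>G. card F = d + 1 - i \<longrightarrow> k \<le> ?s F)"
  proof -
    have "F \<in> \<Delta> \<longleftrightarrow> (\<exists>G\<in>facets \<Delta>. F \<subseteq> G)" for F
    proof
      assume "F \<in> \<Delta>"
      then show "\<exists>G\<in>facets \<Delta>. F \<subseteq> G"
        by (rule face_subset_facet)
    next
      assume "\<exists>G\<in>facets \<Delta>. F \<subseteq> G"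
      then obtain G where "G \<in> \<Delta>" "F \<subseteq> G"
        by (auto simp: facets_def)
      then show "F \<in> \<Delta>"
        using assms(1) by (simp add: simplicial_complex_def)
    qed
    then show ?thesis
      unfolding facets_skeleton[OF assms(1-5)] by auto
  qed
  also have "\<dots> \<longleftrightarrow> (\<forall>G\<in>facets \<Delta>. i + k - 1 \<le> ?s G)"
  proof (intro ball_cong refl)
    fix G assume "G \<in> facets \<Delta>"
    then have "card G = d"
      using card_facet_of_pure_complex assms(1-3) by blast
    then show "(\<forall>F\<subseteq>G. card F = d + 1 - i \<longrightarrow> k \<le> ?s F) \<longleftrightarrow> i + k - 1 \<le> ?s G"
      using sqfree_sum_subsets_ge_iff[OF assms(7) finite[of G], of "i - 1" k] assms(4-6) by simp
  qed
  finally show ?thesis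
    by (simp add: is_cover_def)
qed

text \<open>
  The exponents \<open>(k, c)\<close> of the monomials \<open>x\<^sup>c t\<^sup>k\<close> occurring in elements of the algebra all lie
  in the additive monoid generated by the pairs \<open>(0, c)\<close> and the exponents of the generators.
\<close>

lemma B_alg_support_induct [consumes 2, case_names zero gen add]:
  fixes p :: "('n::finite, 'k::field) mvpoly poly"
  assumes "p \<in> B_alg \<Gamma>" "c \<in> Poly_Mapping.keys (coeff p k)"
    and zero: "\<And>c. P 0 c"
    and gen: "\<And>k c. 1 \<le> k \<Longrightarrow> is_cover \<Gamma> k c \<Longrightarrow> sqfree_exponent c \<Longrightarrow> P k c"
    and add: "\<And>k l a b. P k a \<Longrightarrow> P l b \<Longrightarrow> P (k + l) (a + b)"
  shows "P k c"
  using assms(1,2) unfolding B_alg_def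
proof (induction arbitrary: k c rule: poly_subalgebra.induct)
  case (gen p)
  then obtain e m where "p = monom (xpow e) m" "1 \<le> m" "is_cover \<Gamma> m e" "sqfree_exponent e"
    by blast
  with gen.prems assms(4) show ?case
    by (auto simp: xpow_def split: if_splits)
next
  case (const s)
  then show ?case
    using zero by (cases k) auto
next
  case (add p q)
  then show ?case
    using Poly_Mapping.keys_add[of "coeff p k" "coeff q k"] by auto
next
  case (mult p q)
  then have "c \<in> Poly_Mapping.keys (\<Sum>m\<le>k. coeff p m * coeff q (k - m))"
    by (simp add: coeff_mult)
  then obtain m where m: "m \<le> k" "c \<in> Poly_Mapping.keys (coeff p m * coeff q (k - m))"
    using keys_sum[of "\<lambda>m. coeff p m * coeff q (k - m)" "{..k}"] by auto
  then obtain a b where "a \<in> Poly_Mapping.keys (coeff p m)"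
    "b \<in> Poly_Mapping.keys (coeff q (k - m))" "c = a + b"
    using keys_mult[of "coeff p m" "coeff q (k - m)"] by blast
  then show ?case
    using assms(5)[of m a "k - m" b] mult.IH m(1) by simp
qed

lemma xpow_in_L_ideal_skeleton_iff:
  fixes \<Delta> :: "'n::finite set set"
  assumes "simplicial_complex \<Delta>" "pure_complex \<Delta>" "complex_dim \<Delta> = int d - 1"
    and "1 \<le> i" "i \<le> d" "1 \<le> j" "sqfree_exponent c"
  shows "(xpow c :: ('n, 'k::field) mvpoly) \<in> L_ideal j (skeleton (int d - int i) \<Delta>) \<longleftrightarrow>
         is_cover \<Delta> (i + j - 1) c"
proof
  assume "is_cover \<Delta> (i + j - 1) c"
  then have "is_cover (skeleton (int d - int i) \<Delta>) j c"
    using is_cover_skeleton_iff[OF assms] by simp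
  then show "(xpow c :: ('n, 'k) mvpoly) \<in> L_ideal j (skeleton (int d - int i) \<Delta>)"
    using assms(6,7) unfolding L_ideal_def B_alg_def by (auto intro: poly_subalgebra.gen)
next
  assume "(xpow c :: ('n, 'k) mvpoly) \<in> L_ideal j (skeleton (int d - int i) \<Delta>)"
  then have B: "monom (xpow c :: ('n, 'k) mvpoly) j \<in> B_alg (skeleton (int d - int i) \<Delta>)"
    by (simp add: L_ideal_def)
  have key: "c \<in> Poly_Mapping.keys (coeff (monom (xpow c :: ('n, 'k) mvpoly) j) j)"
    by (simp add: xpow_def)
  have "j = 0 \<or> (\<forall>G\<in>facets \<Delta>. i + j - 1 \<le> (\<Sum>v\<in>G. Poly_Mapping.lookup c v))"
    using B key
  proof (induction rule: B_alg_support_induct)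
    case zero
    then show ?case by simp
  next
    case (gen k c)
    then show ?case
      using is_cover_skeleton_iff[OF assms(1-5)] by (auto simp: is_cover_def)
  next
    case (add k l a b)
    have bound: "\<forall>G\<in>facets \<Delta>. i + (k + l) - 1 \<le> (\<Sum>v\<in>G. Poly_Mapping.lookup (a + b) v)"
      if "k + l \<noteq> 0"
    proof
      fix G assume G: "G \<in> facets \<Delta>"
      let ?s = "\<lambda>e. \<Sum>v\<in>G. Poly_Mapping.lookup e v"
      have "k = 0 \<or> i + k - 1 \<le> ?s a" "l = 0 \<or> i + l - 1 \<le> ?s b"
        using add G by auto
      moreover have "?s (a + b) = ?s a + ?s b"
        by (simp add: lookup_add sum.distrib)
      \<comment> \<open>If \<open>k\<close> or \<open>l\<close> is zero, the bound comes from the other factor alone; otherwise the two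
        bounds add up to at least the required one because \<open>i \<ge> 1\<close>.\<close>
      ultimately show "i + (k + l) - 1 \<le> ?s (a + b)"
        using assms(4) that by linarith
    qed
    show ?case
    proof (cases "k + l = 0")
      case False
      show ?thesis
        by (rule disjI2) (rule bound[OF False])
    qed simp
  qed
  then have bound: "\<forall>G\<in>facets \<Delta>. i + j - 1 \<le> (\<Sum>v\<in>G. Poly_Mapping.lookup c v)"
    using assms(6) by simp
  \<comment> \<open>A complex has a facet, and the sum over it is positive.\<close>
  moreover have "c \<noteq> 0"
  proof -
    obtain F where "F \<in> \<Delta>"
      using assms(1) by (auto simp: simplicial_complex_def)
    then obtain G where "G \<in> facets \<Delta>"
      using face_subset_facet by blast
    then show ?thesis
      using bound assms(4,6) by auto
  qed
  ultimately show "is_cover \<Delta> (i + j - 1) c"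
    by (simp add: is_cover_def)
qed

theorem corollary1p4:
  fixes \<Delta> :: "'n::finite set set" and d i j :: nat
  assumes "simplicial_complex \<Delta>"
    and "pure_complex \<Delta>"
    and "complex_dim \<Delta> = int d - 1"
    and "1 \<le> i" "i \<le> d"
    and "1 \<le> j" "j \<le> d"
  shows "sq_part (L_ideal j (skeleton (int d - int i) \<Delta>) :: ('n, 'k::field) mvpoly set)
       = sq_part (L_ideal i (skeleton (int d - int j) \<Delta>))"
proof -
  have "(xpow c :: ('n, 'k) mvpoly) \<in> L_ideal j (skeleton (int d - int i) \<Delta>) \<longleftrightarrow>
        (xpow c :: ('n, 'k) mvpoly) \<in> L_ideal i (skeleton (int d - int j) \<Delta>)"
    if "sqfree_exponent c" for c :: "'n \<Rightarrow>\<^sub>0 nat"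
    unfolding xpow_in_L_ideal_skeleton_iff[OF assms(1-3) assms(4,5,6) that]
      xpow_in_L_ideal_skeleton_iff[OF assms(1-3) assms(6,7,4) that]
    by (simp add: add.commute)
  then show ?thesis
    unfolding sq_part_def
    by (intro arg_cong[where f = ideal_gen] Collect_cong ex_cong1 conj_cong refl)
qed

end
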